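(* Let $\{\mathcal{P}_n(x)\}_{n\ge 0}$ be the sequence of generalized complementary Romanovski–Routh (GCRR) polynomials, generated by $\mathcal{P}_{-1}(x)=0$, $\mathcal{P}_0(x)=1$, $\mathcal{P}_1(x)=\rho_0(x-c_0)$ and $$\mathcal{P}_{n+1}(x)=\rho_n(x-c_n)\mathcal{P}_n(x)-d_n(x^2+\omega^2)\mathcal{P}_{n-1}(x),\quad n\ge 1,$$ with $\rho_n=1$, $c_n=\frac{\theta}{\zeta+n}$ $(n\ge 0)$, $d_n=\frac{n(2\zeta+n-1)}{4(\zeta+n)(\zeta+n-1)}$ $(n\ge1)$. Let $\{\alpha_n\}_{n\ge 0}$ be a sequence of nonzero real or complex numbers and let $\mathcal{L}_n(x)=\mathcal{P}_n(x)-\alpha_n\mathcal{P}_{n-1}(x)$, $n\ge 0$. Then for all $n\ge 1$ $$(e_nx^2+f_nx+g_n)\mathcal{L}_{n+1}(x)=(p_nx^3+q_nx^2+r_nx+s_n)\mathcal{L}_n(x)+(t_nx^4+u_nx^3+v_nx^2+w_nx+z_n)\mathcal{L}_{n-1}(x),$$ with initial conditions $\mathcal{L}_1(x)=\rho_0(x-\alpha_1\rho_0^{-1}-c_0)$ and $\mathcal{L}_0(x)=1$, where for $n\ge1$ $$e_n=d_{n-1},\quad f_n=-\alpha_{n-1}\rho_{n-1},\quad g_n=d_{n-1}\omega^2+\alpha_{n-1}(\alpha_n+\rho_{n-1}c_{n-1}),$$ $$p_n=\rho_ne_n,\quad q_n=\alpha_{n-1}(d_n-\rho_n\rho_{n-1})-d_{n-1}[\rho_nc_n+\alpha_{n+1}],$$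 $$r_n=\alpha_{n-1}\rho_{n-1}[\alpha_{n+1}+\rho_n(c_n+c_{n-1})]+\rho_nd_{n-1}\omega^2,\quad t_n=-e_{n+1}d_{n-1},$$ $$s_n=-(\alpha_{n-1}\rho_{n-1}c_{n-1}+d_{n-1}\omega^2)(\rho_nc_n+\alpha_{n+1})+\alpha_{n-1}d_n\omega^2,$$ $$u_n=-d_{n-1}f_{n+1},\quad w_n=\omega^2u_n,\quad v_n=-d_{n-1}[g_{n+1}+\omega^2e_{n+1}],\quad z_n=-d_{n-1}\omega^2g_{n+1}.$$
   Context: Here $\zeta>0$, $\theta\in\mathbb{R}$ and $\omega\in\mathbb{R}\setminus\{0\}$ are fixed parameters. The constant $d_0$ appearing in the formulas for $n=1$ is an arbitrary fixed constant: it does not influence the polynomials, because $\mathcal{P}_{-1}=0$, and the recurrence $\mathcal{P}_{n+1}=\rho_n(x-c_n)\mathcal{P}_n-d_n(x^2+\omega^2)\mathcal{P}_{n-1}$ then also holds for $n=0$. Likewise $\alpha_0$ does not influence $\mathcal{L}_0$. *)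

theory Defs
  imports Complex_Main "HOL-Computational_Algebra.Polynomial"
begin

text \<open>
  Coefficients and polynomials are taken over \<open>complex\<close>, which covers real as well as complex
  \<open>\<alpha>\<^sub>n\<close>; the parameters \<open>\<zeta>\<close>, \<open>\<theta>\<close>, \<open>\<omega>\<close> are real and embedded via \<^const>\<open>complex_of_real\<close>.
\<close>

definition gcrr_rho :: "nat \<Rightarrow> complex" where
  "gcrr_rho n = 1"

definition gcrr_c :: "real \<Rightarrow> real \<Rightarrow> nat \<Rightarrow> complex" where
  "gcrr_c \<zeta> \<theta> n = complex_of_real (\<theta> / (\<zeta> + real n))"

text \<open>
  The closed formula for \<open>d\<^sub>n\<close> applies for \<open>n \<ge> 1\<close> only; \<open>d\<^sub>0\<close> is an arbitrary constant \<open>d0\<close>,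
  which the recurrence below never uses.
\<close>

definition gcrr_d :: "real \<Rightarrow> complex \<Rightarrow> nat \<Rightarrow> complex" where
  "gcrr_d \<zeta> d0 n =
     (if n = 0 then d0
      else complex_of_real (real n * (2 * \<zeta> + real n - 1) /
                            (4 * (\<zeta> + real n) * (\<zeta> + real n - 1))))"

text \<open>
  The factors \<open>[:- c, 1:]\<close> and \<open>[:\<omega>\<^sup>2, 0, 1:]\<close> are \<open>x - c\<close> and \<open>x\<^sup>2 + \<omega>\<^sup>2\<close> (coefficient lists
  start with the constant term).
\<close>

fun gcrr_nat :: "real \<Rightarrow> real \<Rightarrow> real \<Rightarrow> complex \<Rightarrow> nat \<Rightarrow> complex poly" where
  "gcrr_nat \<zeta> \<theta> \<omega> d0 0 = 1"
| "gcrr_nat \<zeta> \<theta> \<omega> d0 (Suc 0) = smult (gcrr_rho 0) [:- gcrr_c \<zeta> \<theta> 0, 1:]"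
| "gcrr_nat \<zeta> \<theta> \<omega> d0 (Suc (Suc n)) =
     smult (gcrr_rho (Suc n)) [:- gcrr_c \<zeta> \<theta> (Suc n), 1:] * gcrr_nat \<zeta> \<theta> \<omega> d0 (Suc n)
     - smult (gcrr_d \<zeta> d0 (Suc n)) [:(complex_of_real \<omega>)\<^sup>2, 0, 1:] * gcrr_nat \<zeta> \<theta> \<omega> d0 n"

text \<open>
  The sequence \<open>P\<^sub>k\<close> starts at the index \<open>k = -1\<close> with \<open>P\<^sub>-\<^sub>1 = 0\<close>, hence the integer index; the
  values at \<open>k < -1\<close> are junk.
\<close>

definition gcrr :: "real \<Rightarrow> real \<Rightarrow> real \<Rightarrow> complex \<Rightarrow> int \<Rightarrow> complex poly" where
  "gcrr \<zeta> \<theta> \<omega> d0 k = (if k < 0 then 0 else gcrr_nat \<zeta> \<theta> \<omega> d0 (nat k))"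

definition gcrr_L ::
  "real \<Rightarrow> real \<Rightarrow> real \<Rightarrow> complex \<Rightarrow> (nat \<Rightarrow> complex) \<Rightarrow> nat \<Rightarrow> complex poly" where
  "gcrr_L \<zeta> \<theta> \<omega> d0 \<alpha> n =
     gcrr \<zeta> \<theta> \<omega> d0 (int n) - smult (\<alpha> n) (gcrr \<zeta> \<theta> \<omega> d0 (int n - 1))"

end

theory Submission imports Defs begin

text \<open>
  Fix \<open>n \<ge> 1\<close>, put \<open>W = x\<^sup>2 + \<omega>\<^sup>2\<close>, \<open>Y\<^sub>k = \<rho>\<^sub>k (x - c\<^sub>k)\<close> and
  \<open>D\<^sub>k = d\<^sub>k\<^sub>-\<^sub>1 W - \<alpha>\<^sub>k\<^sub>-\<^sub>1 Y\<^sub>k\<^sub>-\<^sub>1 + \<alpha>\<^sub>k\<^sub>-\<^sub>1 \<alpha>\<^sub>k\<close>. The recurrence for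
  \<open>P\<^sub>n\<^sub>+\<^sub>1\<close>, and the one for \<open>P\<^sub>n\<close> used to eliminate \<open>P\<^sub>n\<^sub>-\<^sub>2\<close>, express \<open>L\<^sub>n\<^sub>+\<^sub>1\<close>, \<open>L\<^sub>n\<close> and
  \<open>d\<^sub>n\<^sub>-\<^sub>1 W L\<^sub>n\<^sub>-\<^sub>1\<close> as combinations of \<open>P\<^sub>n\<close> and \<open>P\<^sub>n\<^sub>-\<^sub>1\<close>. The last two
  have determinant \<open>D\<^sub>n\<close> with respect to \<open>P\<^sub>n\<close> and \<open>P\<^sub>n\<^sub>-\<^sub>1\<close>, so Cramer's rule writes
  \<open>D\<^sub>n L\<^sub>n\<^sub>+\<^sub>1\<close> in terms of them; the multiplier of \<open>d\<^sub>n\<^sub>-\<^sub>1 W L\<^sub>n\<^sub>-\<^sub>1\<close> turns out to be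
  \<open>- D\<^sub>n\<^sub>+\<^sub>1\<close>. This is \<open>quasi_orthogonal_recurrence\<close>, an identity in any commutative
  ring. Reading off the coefficients of the polynomials in it gives \<open>e\<^sub>n, \<dots>, z\<^sub>n\<close>.
\<close>

text \<open>
  The case \<open>n = 0\<close> is included because \<open>P\<^sub>-\<^sub>1 = 0\<close>, whatever \<open>d\<^sub>0\<close> is.
\<close>

lemma gcrr_recurrence:
  "gcrr \<zeta> \<theta> \<omega> d0 (int n + 1) =
     smult (gcrr_rho n) [:- gcrr_c \<zeta> \<theta> n, 1:] * gcrr \<zeta> \<theta> \<omega> d0 (int n)
     - smult (gcrr_d \<zeta> d0 n) [:(complex_of_real \<omega>)\<^sup>2, 0, 1:] * gcrr \<zeta> \<theta> \<omega> d0 (int n - 1)"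
proof (cases n)
  case 0
  then show ?thesis by (simp add: gcrr_def)
next
  case (Suc m)
  have "nat (int (Suc m) + 1) = Suc (Suc m)" "nat (1 + int m) = Suc m" by simp_all
  with Suc show ?thesis by (simp add: gcrr_def)
qed

text \<open>
  The letters stand for \<open>P2 = P\<^sub>n\<^sub>+\<^sub>1, P1 = P\<^sub>n, P0 = P\<^sub>n\<^sub>-\<^sub>1, P' = P\<^sub>n\<^sub>-\<^sub>2\<close>, and
  \<open>a2, a1, a0\<close> for \<open>\<alpha>\<^sub>n\<^sub>+\<^sub>1, \<alpha>\<^sub>n, \<alpha>\<^sub>n\<^sub>-\<^sub>1\<close>, \<open>Y1, Y0\<close> for
  \<open>Y\<^sub>n, Y\<^sub>n\<^sub>-\<^sub>1\<close>, and \<open>d1, d0\<close> for \<open>d\<^sub>n, d\<^sub>n\<^sub>-\<^sub>1\<close>.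
\<close>

lemma quasi_orthogonal_recurrence:
  fixes P2 P1 P0 P' Y1 Y0 d1 d0 W a2 a1 a0 :: "'a :: comm_ring_1"
  assumes "P2 = Y1 * P1 - d1 * W * P0" and "P1 = Y0 * P0 - d0 * W * P'"
  shows "(d0 * W - a0 * Y0 + a0 * a1) * (P2 - a2 * P1) =
           ((Y1 - a2) * (d0 * W - a0 * Y0) + a0 * d1 * W) * (P1 - a1 * P0)
           - d0 * W * (d1 * W - a1 * Y1 + a1 * a2) * (P0 - a0 * P')"
  unfolding assms by (simp add: algebra_simps)

theorem theorem2p1:
  fixes \<zeta> \<theta> \<omega> :: real and d0 :: complex and \<alpha> :: "nat \<Rightarrow> complex"
    and \<rho> c d e f g p q r s t u v w z :: "nat \<Rightarrow> complex"
    and \<omega>c :: complex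
    and L :: "nat \<Rightarrow> complex poly"
  assumes zeta: "\<zeta> > 0"
    and omega: "\<omega> \<noteq> 0"
    and alpha: "\<And>n. \<alpha> n \<noteq> 0"
  defines "\<omega>c \<equiv> complex_of_real \<omega>"
    and "\<rho> \<equiv> gcrr_rho"
    and "c \<equiv> gcrr_c \<zeta> \<theta>"
    and "d \<equiv> gcrr_d \<zeta> d0"
    and "L \<equiv> gcrr_L \<zeta> \<theta> \<omega> d0 \<alpha>"
  assumes e: "\<And>n. n \<ge> 1 \<Longrightarrow> e n = d (n - 1)"
    and f: "\<And>n. n \<ge> 1 \<Longrightarrow> f n = - \<alpha> (n - 1) * \<rho> (n - 1)"
    and g: "\<And>n. n \<ge> 1 \<Longrightarrow>
          g n = d (n - 1) * \<omega>c\<^sup>2 + \<alpha> (n - 1) * (\<alpha> n + \<rho> (n - 1) * c (n - 1))"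
    and p: "\<And>n. n \<ge> 1 \<Longrightarrow> p n = \<rho> n * e n"
    and q: "\<And>n. n \<ge> 1 \<Longrightarrow>
          q n = \<alpha> (n - 1) * (d n - \<rho> n * \<rho> (n - 1)) - d (n - 1) * (\<rho> n * c n + \<alpha> (n + 1))"
    and r: "\<And>n. n \<ge> 1 \<Longrightarrow>
          r n = \<alpha> (n - 1) * \<rho> (n - 1) * (\<alpha> (n + 1) + \<rho> n * (c n + c (n - 1)))
                + \<rho> n * d (n - 1) * \<omega>c\<^sup>2"
    and t: "\<And>n. n \<ge> 1 \<Longrightarrow> t n = - e (n + 1) * d (n - 1)"
    and s: "\<And>n. n \<ge> 1 \<Longrightarrow>
          s n = - (\<alpha> (n - 1) * \<rho> (n - 1) * c (n - 1) + d (n - 1) * \<omega>c\<^sup>2)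
                  * (\<rho> n * c n + \<alpha> (n + 1))
                + \<alpha> (n - 1) * d n * \<omega>c\<^sup>2"
    and u: "\<And>n. n \<ge> 1 \<Longrightarrow> u n = - d (n - 1) * f (n + 1)"
    and w: "\<And>n. n \<ge> 1 \<Longrightarrow> w n = \<omega>c\<^sup>2 * u n"
    and v: "\<And>n. n \<ge> 1 \<Longrightarrow> v n = - d (n - 1) * (g (n + 1) + \<omega>c\<^sup>2 * e (n + 1))"
    and z: "\<And>n. n \<ge> 1 \<Longrightarrow> z n = - d (n - 1) * \<omega>c\<^sup>2 * g (n + 1)"
  shows "(\<forall>n\<ge>1. [:g n, f n, e n:] * L (n + 1) =
             [:s n, r n, q n, p n:] * L n + [:z n, w n, v n, u n, t n:] * L (n - 1))
         \<and> L 1 = smult (\<rho> 0) [:- \<alpha> 1 * inverse (\<rho> 0) - c 0, 1:]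
         \<and> L 0 = 1"
proof (intro conjI allI impI)
  fix n :: nat
  assume "1 \<le> n"
  then obtain m where n: "n = Suc m" by (cases n) auto
  let ?P = "gcrr \<zeta> \<theta> \<omega> d0"
  let ?W = "[:\<omega>c\<^sup>2, 0, 1:]"
  let ?Y = "\<lambda>k. smult (\<rho> k) [:- c k, 1:]"
  \<comment> \<open>the determinant \<open>D\<^sub>k\<^sub>+\<^sub>1\<close> of the introduction, with the index shifted to avoid \<open>k - 1\<close>\<close>
  let ?D = "\<lambda>k. [:d k:] * ?W - [:\<alpha> k:] * ?Y k + [:\<alpha> k:] * [:\<alpha> (Suc k):]"
  have P2: "?P (int m + 2) = ?Y n * ?P (int m + 1) - [:d n:] * ?W * ?P (int m)"
    using gcrr_recurrence[of \<zeta> \<theta> \<omega> d0 n]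
    by (simp add: n \<rho>_def c_def d_def \<omega>c_def ac_simps)
  have P1: "?P (int m + 1) = ?Y m * ?P (int m) - [:d m:] * ?W * ?P (int m - 1)"
    using gcrr_recurrence[of \<zeta> \<theta> \<omega> d0 m]
    by (simp add: \<rho>_def c_def d_def \<omega>c_def ac_simps)
  have L: "L (n + 1) = ?P (int m + 2) - [:\<alpha> (Suc n):] * ?P (int m + 1)"
    "L n = ?P (int m + 1) - [:\<alpha> n:] * ?P (int m)"
    "L (n - 1) = ?P (int m) - [:\<alpha> m:] * ?P (int m - 1)"
    by (simp_all add: L_def gcrr_L_def n add.commute)
  have D: "[:g (Suc k), f (Suc k), e (Suc k):] = ?D k" for k
    by (simp add: e f g algebra_simps)
  have Ln: "[:s n, r n, q n, p n:] =
      (?Y n - [:\<alpha> (Suc n):]) * ([:d m:] * ?W - [:\<alpha> m:] * ?Y m) + [:\<alpha> m:] * [:d n:] * ?W"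
    by (simp add: n e p q r s algebra_simps)
  have "[:z n, w n, v n, u n, t n:] = - ([:d m:] * ?W * [:g (Suc n), f (Suc n), e (Suc n):])"
    by (simp add: n t u v w z algebra_simps)
  then have Lm: "[:z n, w n, v n, u n, t n:] = - ([:d m:] * ?W * ?D n)"
    by (simp only: D)
  show "[:g n, f n, e n:] * L (n + 1) =
      [:s n, r n, q n, p n:] * L n + [:z n, w n, v n, u n, t n:] * L (n - 1)"
    using quasi_orthogonal_recurrence[OF P2 P1, of "[:\<alpha> m:]" "[:\<alpha> n:]" "[:\<alpha> (Suc n):]"]
      D[of m, folded n]
    unfolding L Ln Lm by (simp only: n mult_minus_left diff_conv_add_uminus)
next
  show "L 1 = smult (\<rho> 0) [:- \<alpha> 1 * inverse (\<rho> 0) - c 0, 1:]"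
    by (simp add: L_def gcrr_L_def gcrr_def \<rho>_def gcrr_rho_def c_def one_pCons)
next
  show "L 0 = 1"
    by (simp add: L_def gcrr_L_def gcrr_def)
qed

end
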